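(* Let $n\ge 1$ and $m\ge 1$ be integers, and let $R\in\mathbb{R}^{n\times n}$ be the upper triangular banded matrix with entries $R_{\ell,\ell}=d_\ell$ for $1\le \ell\le n$, $R_{\ell,\ell+1}=-e_\ell$ for $1\le\ell\le n-1$, $R_{\ell,\ell+2}=-f_\ell$ for $1\le\ell\le n-2$, and all other entries zero, where $$d_\ell = (\ell+m-1)\sqrt{\frac{(\ell+m+1)(\ell+2m)(\ell+2m+1)}{(\ell+m)(2\ell+2m-1)(2\ell+2m+1)}},$$ $$e_\ell = \sqrt{\frac{\ell(\ell+2m+1)}{(\ell+m)(\ell+m+1)}},$$ $$f_\ell = (\ell+m+2)\sqrt{\frac{\ell(\ell+1)(\ell+m)}{(\ell+m+1)(2\ell+2m+1)(2\ell+2m+3)}}.$$ If $m=1$, then $$\kappa_2(R) \le \left(n+\tfrac{5}{2}\right)\left(4e^{1+\frac{7\pi^2}{8}}\left[2+\log n\right]\right).$$ Otherwise, if $m\ge2$, then $$\kappa_2(R) \le \frac{n+m+\frac{3}{2}}{m-\frac{3}{2}}.$$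
   Context: $\kappa_2(R)=\|R\|_2\,\|R^{-1}\|_2$ denotes the $2$-norm relative condition number, where $\|\cdot\|_2$ is the operator norm induced by the Euclidean norm. $\log$ is the natural logarithm. In the constant $4e^{1+7\pi^2/8}$, $e$ is the base of the natural logarithm (not one of the entries $e_\ell$). *)

theory Defs
  imports "HOL-Analysis.Analysis"
begin

definition d_entry :: "nat \<Rightarrow> nat \<Rightarrow> real" where
  "d_entry m l = (real l + real m - 1) *
     sqrt (((real l + real m + 1) * (real l + 2 * real m) * (real l + 2 * real m + 1)) /
           ((real l + real m) * (2 * real l + 2 * real m - 1) * (2 * real l + 2 * real m + 1)))"

definition e_entry :: "nat \<Rightarrow> nat \<Rightarrow> real" where
  "e_entry m l = sqrt ((real l * (real l + 2 * real m + 1)) /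
                 ((real l + real m) * (real l + real m + 1)))"

definition f_entry :: "nat \<Rightarrow> nat \<Rightarrow> real" where
  "f_entry m l = (real l + real m + 2) *
     sqrt ((real l * (real l + 1) * (real l + real m)) /
           ((real l + real m + 1) * (2 * real l + 2 * real m + 1) * (2 * real l + 2 * real m + 3)))"

text \<open>The index type \<^typ>\<open>'n\<close> plays the role of \<open>{1, \<dots>, n}\<close> with \<open>n = CARD('n)\<close>:
  \<open>index\<close> is the unique order isomorphism from a finite linearly ordered type onto
  \<open>{1..CARD('n)}\<close>. Every \<open>n \<ge> 1\<close> is the cardinality of such a type.\<close>

definition index :: "'n::{finite, linorder} \<Rightarrow> nat" where
  "index i = card {..i}"

definition R_mat :: "nat \<Rightarrow> real ^ ('n::{finite, linorder}) ^ ('n::{finite, linorder})" where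
  "R_mat m = (\<chi> i j.
     if index j = index i then d_entry m (index i)
     else if index j = index i + 1 then - e_entry m (index i)
     else if index j = index i + 2 then - f_entry m (index i)
     else 0)"

definition op_norm2 :: "real ^ 'n ^ 'm \<Rightarrow> real" where
  "op_norm2 A = onorm (\<lambda>x. A *v x)"

text \<open>Only meaningful for invertible \<open>A\<close>. The matrix \<open>R_mat m\<close> with \<open>m \<ge> 1\<close> is invertible, being
  upper triangular with positive diagonal entries.\<close>

definition kappa2 :: "real ^ 'n ^ 'n \<Rightarrow> real" where
  "kappa2 A = op_norm2 A * op_norm2 (matrix_inv A)"

end

theory Submission
  imports Defs
begin

text \<open>The entries satisfy \<open>l/2 + m - 1/2 \<le> d\<^sub>l \<le> l/2 + m\<close>, \<open>e\<^sub>l \<le> 1\<close> and \<open>f\<^sub>l \<le> (l + 1)/2\<close>. Summing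
  the three diagonals bounds \<open>\<parallel>R\<parallel>\<close> by \<open>n + m + 3/2\<close>. Although \<open>R\<close> need not be row diagonally
  dominant by \<open>m - 3/2\<close>, the average of its rows and columns is, so that
  \<open>x \<bullet> R x \<ge> (m - 3/2) \<parallel>x\<parallel>\<^sup>2\<close>, which settles \<open>m \<ge> 2\<close>. For \<open>m = 1\<close> this is void, and a Schur test
  with weights of the size of \<open>(1 + log (n/l)) / \<surd>l\<close> and \<open>(1 + log l) / \<surd>l\<close> gives
  \<open>\<parallel>R\<^sup>-\<^sup>1\<parallel> \<le> 2 (1 + log n)\<close>.\<close>

section \<open>Bounds for general matrices\<close>

lemma power2_norm_vec: "(norm (x :: real ^ 'n))\<^sup>2 = (\<Sum>i\<in>UNIV. (x $ i)\<^sup>2)"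
  unfolding power2_norm_eq_inner inner_vec_def by (simp add: power2_eq_square)

lemma matrix_inv_right: "invertible A \<Longrightarrow> A ** matrix_inv A = mat 1"
  unfolding invertible_def matrix_inv_def by (rule someI2_ex) auto

text \<open>The lower estimate makes \<open>A\<close> injective, hence invertible, so
  \<open>matrix_inv A\<close> is a true inverse. Taking \<open>x = matrix_inv A *v y\<close> in it
  bounds the norm of the inverse by \<open>c\<close>.\<close>

lemma kappa2_le:
  fixes A :: "real ^ 'n ^ 'n"
  assumes upper: "\<And>x. norm (A *v x) \<le> K * norm x"
    and lower: "\<And>x. norm x \<le> c * norm (A *v x)"
  shows "kappa2 A \<le> K * c"
proof -
  have "x = 0" if "A *v x = 0" for x
    using lower[of x] that by simp
  then have "inj ((*v) A)"
    by (simp add: vec.inj_iff_eq_0)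
  then have inv: "invertible A"
    by (simp add: invertible_left_inverse matrix_left_invertible_injective)
  have "norm (matrix_inv A *v y) \<le> c * norm y" for y
    using lower[of "matrix_inv A *v y"] matrix_inv_right[OF inv]
    by (simp add: matrix_vector_mul_assoc)
  then have "op_norm2 (matrix_inv A) \<le> c"
    unfolding op_norm2_def by (rule onorm_le)
  moreover have K: "op_norm2 A \<le> K"
    unfolding op_norm2_def using upper by (rule onorm_le)
  moreover have nonneg: "0 \<le> op_norm2 B" for B :: "real ^ 'n ^ 'n"
    unfolding op_norm2_def by (simp add: onorm_pos_le)
  ultimately show ?thesis
    unfolding kappa2_def using order_trans[OF nonneg K] by (intro mult_mono) auto
qed

text \<open>Cauchy-Schwarz bounds the quadratic form by \<open>norm x * norm (A *v x)\<close>, and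
  one factor \<open>norm x\<close> cancels.\<close>

lemma norm_le_of_inner_ge:
  fixes A :: "real ^ 'n ^ 'n"
  assumes "c > 0" and "c * (norm x)\<^sup>2 \<le> x \<bullet> (A *v x)"
  shows "norm x \<le> 1 / c * norm (A *v x)"
proof (cases "x = 0")
  case False
  have "norm x * (c * norm x) \<le> norm x * norm (A *v x)"
    using assms(2) norm_cauchy_schwarz[of x "A *v x"] by (simp add: power2_eq_square mult_ac)
  with False have "c * norm x \<le> norm (A *v x)"
    by simp
  with \<open>c > 0\<close> show ?thesis
    by (simp add: field_simps)
qed simp

text \<open>A Schur test for the inverse of a matrix with nonpositive off-diagonal entries. It needs no
  sign information on the inverse: the function \<open>(t, s) \<mapsto> t\<^sup>2 / s\<close> is convex, so \<open>x\<^sub>j\<^sup>2 / q\<^sub>j\<close> lies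
  above its linearisation at the point \<open>i\<close>, with equality for \<open>j = i\<close>.\<close>

lemma weighted_lower_bound:
  fixes A :: "real ^ 'n ^ 'n" and p q :: "real ^ 'n"
  assumes off_diag: "\<And>i j. i \<noteq> j \<Longrightarrow> A $ i $ j \<le> 0"
    and q_pos: "\<And>i. q $ i > 0" and p_nonneg: "\<And>i. p $ i \<ge> 0"
    and a: "a > 0" and b: "b \<ge> 0"
    and row: "\<And>i. p $ i \<le> a * (A *v q) $ i"
    and col: "\<And>j. q $ j \<le> b * (transpose A *v p) $ j"
  shows "(norm x)\<^sup>2 \<le> a * b * (norm (A *v x))\<^sup>2"
proof -
  define u where "u j = (x $ j)\<^sup>2 / q $ j" for j
  have u_nonneg: "u j \<ge> 0" for j
    using q_pos[of j] by (simp add: u_def)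
  have u_q: "u j * q $ j = (x $ j)\<^sup>2" for j
    using q_pos[of j] by (simp add: u_def)
  have row_u: "p $ i * (\<Sum>j\<in>UNIV. A $ i $ j * u j) \<le> a * ((A *v x) $ i)\<^sup>2" for i
  proof -
    \<comment> \<open>The linearisation of \<open>v^2 / s\<close> at \<open>(x $ i, q $ i)\<close>
      is \<open>2 * t * v - t^2 * s\<close> with this ratio \<open>t\<close>.\<close>
    define t where "t = x $ i / q $ i"
    have "A $ i $ j * u j \<le> A $ i $ j * (2 * t * x $ j - t\<^sup>2 * q $ j)" for j
    proof (cases "i = j")
      case True
      then show ?thesis
        using q_pos[of i] by (simp add: u_def t_def power2_eq_square field_simps)
    next
      case False
      have "u j - (2 * t * x $ j - t\<^sup>2 * q $ j) = (x $ j - t * q $ j)\<^sup>2 / q $ j"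
        using q_pos[of j] by (simp add: u_def power2_eq_square field_simps)
      also have "\<dots> \<ge> 0"
        using q_pos[of j] by simp
      finally show ?thesis
        using off_diag[OF False] by (intro mult_left_mono_neg) auto
    qed
    then have "(\<Sum>j\<in>UNIV. A $ i $ j * u j)
        \<le> (\<Sum>j\<in>UNIV. A $ i $ j * (2 * t * x $ j - t\<^sup>2 * q $ j))"
      by (intro sum_mono)
    also have "\<dots> = 2 * t * (A *v x) $ i - t\<^sup>2 * (A *v q) $ i"
      by (simp add: matrix_vector_mult_def sum_distrib_left sum_subtractf[symmetric] algebra_simps)
    also have "\<dots> \<le> 2 * t * (A *v x) $ i - t\<^sup>2 * (p $ i / a)"
      using row[of i] a by (intro diff_left_mono mult_left_mono) (auto simp: field_simps)
    finally have "p $ i * (\<Sum>j\<in>UNIV. A $ i $ j * u j)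
        \<le> p $ i * (2 * t * (A *v x) $ i - t\<^sup>2 * (p $ i / a))"
      using p_nonneg by (intro mult_left_mono)
    \<comment> \<open>Completing the square removes \<open>t\<close>, so that only the
      \<open>i\<close>-th component of \<open>A *v x\<close> remains.\<close>
    also have "a * ((A *v x) $ i)\<^sup>2 - \<dots> = (a * (A *v x) $ i - t * p $ i)\<^sup>2 / a"
      using a by (simp add: power2_eq_square field_simps)
    then have "p $ i * (2 * t * (A *v x) $ i - t\<^sup>2 * (p $ i / a)) \<le> a * ((A *v x) $ i)\<^sup>2"
      using a by (smt (verit) divide_nonneg_pos zero_le_power2)
    finally show ?thesis .
  qed
  have "(norm x)\<^sup>2 = (\<Sum>j\<in>UNIV. u j * q $ j)"
    by (simp add: power2_norm_vec u_q)
  \<comment> \<open>The column hypothesis enters here; exchanging the two sums then leaves row sums,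
    to which \<open>row_u\<close> applies.\<close>
  also have "\<dots> \<le> (\<Sum>j\<in>UNIV. u j * (b * (transpose A *v p) $ j))"
    using col u_nonneg by (intro sum_mono mult_left_mono)
  also have "\<dots> = (\<Sum>j\<in>UNIV. \<Sum>i\<in>UNIV. b * (p $ i * (A $ i $ j * u j)))"
    by (simp add: matrix_vector_mult_def transpose_def sum_distrib_left mult_ac)
  also have "\<dots> = (\<Sum>i\<in>UNIV. \<Sum>j\<in>UNIV. b * (p $ i * (A $ i $ j * u j)))"
    by (rule sum.swap)
  also have "\<dots> = b * (\<Sum>i\<in>UNIV. p $ i * (\<Sum>j\<in>UNIV. A $ i $ j * u j))"
    by (simp add: sum_distrib_left)
  also have "\<dots> \<le> b * (\<Sum>i\<in>UNIV. a * ((A *v x) $ i)\<^sup>2)"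
    using row_u b by (intro mult_left_mono sum_mono)
  also have "\<dots> = a * b * (norm (A *v x))\<^sup>2"
    by (simp add: power2_norm_vec sum_distrib_left mult_ac)
  finally show ?thesis .
qed

section \<open>Vectors over a finite linear order as sequences\<close>

lemma index_bij: "bij_betw index (UNIV :: 'n::{finite, linorder} set) {1..CARD('n)}"
proof -
  have "index i < index j" if "i < j" for i j :: 'n
    unfolding index_def using that by (intro psubset_card_mono) auto
  then have inj: "inj (index :: 'n \<Rightarrow> nat)"
    by (metis injI linorder_neqE nat_neq_iff)
  have "index i \<in> {1..CARD('n)}" for i :: 'n
    unfolding index_def by (auto simp: Suc_le_eq card_gt_0_iff intro: card_mono)
  then have "range (index :: 'n \<Rightarrow> nat) \<subseteq> {1..CARD('n)}"
    by blast
  moreover have "card (range (index :: 'n \<Rightarrow> nat)) = card {1..CARD('n)}"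
    using inj by (simp add: card_image)
  ultimately have "range (index :: 'n \<Rightarrow> nat) = {1..CARD('n)}"
    by (intro card_subset_eq) auto
  with inj show ?thesis
    by (simp add: bij_betw_def)
qed

lemma index_eq_iff: "index i = index j \<longleftrightarrow> i = j"
  using index_bij by (metis UNIV_I bij_betw_imp_inj_on inj_onD)

lemma index_ge_1: "index i \<ge> 1"
  using index_bij by (metis UNIV_I bij_betwE atLeastAtMost_iff)

lemma index_neq_0 [simp]: "index i \<noteq> 0"
  using index_ge_1[of i] by linarith

lemma index_le_card: "index (i :: 'n::{finite, linorder}) \<le> CARD('n)"
  using index_bij by (metis UNIV_I bij_betwE atLeastAtMost_iff)

lemma sum_index: "(\<Sum>i\<in>(UNIV :: 'n::{finite, linorder} set). g (index i)) = (\<Sum>l=1..CARD('n). g l)"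
  by (rule sum.reindex_bij_betw[OF index_bij])

text \<open>Extends a vector by zero to a sequence on all naturals: the sum has one term or none.
  Neighbours beyond either end can then be named without case distinctions.\<close>

definition entry :: "'a::comm_monoid_add ^ 'n::{finite, linorder} \<Rightarrow> nat \<Rightarrow> 'a" where
  "entry x k = (\<Sum>j | index j = k. x $ j)"

lemma entry_index [simp]: "entry x (index i) = x $ i"
  by (simp add: entry_def index_eq_iff)

lemma entry_out_of_range:
  "k = 0 \<or> k > CARD('n) \<Longrightarrow> entry (x :: 'a::comm_monoid_add ^ 'n::{finite, linorder}) k = 0"
  unfolding entry_def using index_le_card[where 'n = 'n]
  by (intro sum.neutral) (auto simp: not_le[symmetric])

lemma entry_lambda:
  assumes "k \<in> {1..CARD('n)}"
  shows "entry (\<chi> i::'n::{finite, linorder}. g (index i)) k = g k"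
proof -
  obtain j :: 'n where "k = index j"
    using assms index_bij by (metis bij_betw_iff_bijections)
  then show ?thesis
    by simp
qed

lemma sum_entry_eq: "(\<Sum>j\<in>UNIV. if index j = k then x $ j else 0) = entry x k"
  by (simp add: entry_def sum.If_cases)

text \<open>Shifting drops the first \<open>s\<close> terms, which are nonnegative, and brings in
  only zeros past the end.\<close>

lemma sum_shift_entry_le:
  fixes x :: "real ^ 'n::{finite, linorder}"
  assumes "\<And>l. l \<ge> 1 \<Longrightarrow> g l \<ge> 0"
  shows "(\<Sum>i\<in>(UNIV :: 'n set). g (index i + s) * (entry x (index i + s))\<^sup>2)
    \<le> (\<Sum>i\<in>UNIV. g (index i) * (x $ i)\<^sup>2)"
proof -
  define h where "h l = g l * (entry x l)\<^sup>2" for l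
  have "(\<Sum>i\<in>(UNIV :: 'n set). h (index i + s)) = (\<Sum>l=1..CARD('n). h (l + s))"
    by (rule sum_index)
  also have "\<dots> = sum h {1 + s..CARD('n) + s}"
    by (simp only: sum.shift_bounds_cl_nat_ivl)
  also have "\<dots> = sum h {1 + s..CARD('n)}"
    by (intro sum.mono_neutral_right) (auto simp: h_def entry_out_of_range)
  also have "\<dots> \<le> sum h {1..CARD('n)}"
    using assms by (intro sum_mono2) (auto simp: h_def)
  also have "\<dots> = (\<Sum>i\<in>(UNIV :: 'n set). h (index i))"
    by (rule sum_index[symmetric])
  finally show ?thesis
    by (simp add: h_def)
qed

text \<open>This is the operator norm of a single diagonal: the shift does not increase the norm,
  and the coefficients contribute at most \<open>C\<close>.\<close>

lemma norm_scaled_shift_le: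
  fixes x :: "real ^ 'n::{finite, linorder}"
  assumes "C \<ge> 0" and "\<And>i. \<bar>c i\<bar> \<le> C"
  shows "norm (\<chi> i::'n. c i * entry x (index i + s)) \<le> C * norm x"
proof -
  have "(norm (\<chi> i::'n. c i * entry x (index i + s)))\<^sup>2
      = (\<Sum>i\<in>UNIV. \<bar>c i\<bar>\<^sup>2 * (entry x (index i + s))\<^sup>2)"
    by (simp add: power2_norm_vec power_mult_distrib)
  also have "\<dots> \<le> (\<Sum>i\<in>(UNIV :: 'n set). C\<^sup>2 * (entry x (index i + s))\<^sup>2)"
    using assms by (intro sum_mono mult_right_mono power_mono) auto
  also have "\<dots> \<le> (\<Sum>i\<in>UNIV. C\<^sup>2 * (x $ i)\<^sup>2)"
    by (rule sum_shift_entry_le[where g = "\<lambda>_. C\<^sup>2"]) simp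
  also have "\<dots> = (C * norm x)\<^sup>2"
    by (simp add: power2_norm_vec power_mult_distrib sum_distrib_left)
  finally show ?thesis
    by (rule power2_le_imp_le) (use assms in simp)
qed

section \<open>The banded matrix\<close>

lemma R_mat_mult:
  fixes x :: "real ^ 'n::{finite, linorder}"
  shows "(R_mat m *v x) $ i = d_entry m (index i) * x $ i
    - e_entry m (index i) * entry x (index i + 1) - f_entry m (index i) * entry x (index i + 2)"
proof -
  have "(R_mat m *v x) $ i = (\<Sum>j\<in>UNIV.
      d_entry m (index i) * (if index j = index i then x $ j else 0)
      - e_entry m (index i) * (if index j = index i + 1 then x $ j else 0)
      - f_entry m (index i) * (if index j = index i + 2 then x $ j else 0))"
    unfolding matrix_vector_mult_def R_mat_def by (simp, intro sum.cong) auto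
  then show ?thesis
    by (simp only: sum_subtractf sum_distrib_left[symmetric] sum_entry_eq entry_index)
qed

text \<open>Truncated subtraction is harmless in the first two columns: it yields position 0, where
  \<open>entry x\<close> vanishes.\<close>

lemma transpose_R_mat_mult:
  fixes x :: "real ^ 'n::{finite, linorder}"
  shows "(transpose (R_mat m) *v x) $ j = d_entry m (index j) * x $ j
    - e_entry m (index j - 1) * entry x (index j - 1)
    - f_entry m (index j - 2) * entry x (index j - 2)"
proof -
  have "(transpose (R_mat m) *v x) $ j = (\<Sum>i\<in>UNIV.
      d_entry m (index j) * (if index i = index j then x $ i else 0)
      - e_entry m (index j - 1) * (if index i = index j - 1 then x $ i else 0)
      - f_entry m (index j - 2) * (if index i = index j - 2 then x $ i else 0))"
    proof -
    have "index j = index i + 1 \<longleftrightarrow> index i = index j - 1"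
      "index j = index i + 2 \<longleftrightarrow> index i = index j - 2" for i :: 'n
      using index_ge_1[of i] index_ge_1[of j] by auto
    then show ?thesis
      unfolding matrix_vector_mult_def transpose_def R_mat_def
      using index_ge_1[of j] by (simp del: One_nat_def, intro sum.cong) auto
  qed
  then show ?thesis
    by (simp only: sum_subtractf sum_distrib_left[symmetric] sum_entry_eq entry_index)
qed


section \<open>Bounds for the entries on the three diagonals\<close>

lemma d_entry_power2:
  assumes "l \<ge> 1"
  shows "(d_entry m l)\<^sup>2 = (real l + real m - 1)\<^sup>2 *
     (((real l + real m + 1) * (real l + 2 * real m) * (real l + 2 * real m + 1)) /
       ((real l + real m) * (2 * real l + 2 * real m - 1) * (2 * real l + 2 * real m + 1)))"
  unfolding d_entry_def power_mult_distrib using assms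
  by (subst real_sqrt_pow2, intro divide_nonneg_nonneg mult_nonneg_nonneg) auto

lemma f_entry_power2:
  "(f_entry m l)\<^sup>2 = (real l + real m + 2)\<^sup>2 *
     ((real l * (real l + 1) * (real l + real m)) /
       ((real l + real m + 1) * (2 * real l + 2 * real m + 1) * (2 * real l + 2 * real m + 3)))"
  unfolding f_entry_def power_mult_distrib
  by (subst real_sqrt_pow2, intro divide_nonneg_nonneg mult_nonneg_nonneg) auto

lemma d_entry_nonneg: "l \<ge> 1 \<Longrightarrow> d_entry m l \<ge> 0"
  unfolding d_entry_def
  by (intro mult_nonneg_nonneg real_sqrt_ge_zero divide_nonneg_nonneg) auto

lemma e_entry_nonneg: "e_entry m l \<ge> 0"
  unfolding e_entry_def
  by (intro mult_nonneg_nonneg real_sqrt_ge_zero divide_nonneg_nonneg) auto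

lemma f_entry_nonneg: "f_entry m l \<ge> 0"
  unfolding f_entry_def
  by (intro mult_nonneg_nonneg real_sqrt_ge_zero divide_nonneg_nonneg) auto

lemma e_entry_le:
  assumes "l \<ge> 1"
  shows "e_entry m l \<le> 1"
proof -
  have "real l * (real l + 2 * real m + 1) \<le> (real l + real m) * (real l + real m + 1)"
    by (simp add: algebra_simps)
  moreover have "0 < (real l + real m) * (real l + real m + 1)"
    using assms by simp
  ultimately show ?thesis
    unfolding e_entry_def by (simp add: divide_le_eq_1)
qed

text \<open>After squaring and clearing denominators a factor \<open>s\<close> cancels, and the
  polynomial difference that is left has only nonnegative coefficients in \<open>a = l - 1\<close>
  and \<open>b = m - 1\<close>. The bounds \<open>d_entry_ge\<close> and \<open>f_entry_le\<close>
  rest on the same substitution.\<close>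

lemma d_entry_le:
  assumes "l \<ge> 1" "m \<ge> 1"
  shows "d_entry m l \<le> real l / 2 + real m"
proof (rule power2_le_imp_le)
  obtain a b where ab: "l = Suc a" "m = Suc b"
    using assms by (metis One_nat_def Suc_le_D)
  define k s where "k = real l + real m" and "s = k + real m"
  have k: "k \<ge> 2" "s \<ge> 0"
    using assms by (auto simp: k_def s_def)
  have "s * (k * (4 * k\<^sup>2 - 1)) - 4 * (k - 1)\<^sup>2 * (k + 1) * (s + 1)
     = 42 + 65 * real b + 30 * real b ^ 2 + 4 * real b ^ 3 + 47 * real a + 41 * real a * real b
      + 8 * real a * real b ^ 2 + 11 * real a ^ 2 + 4 * real a ^ 2 * real b"
    unfolding k_def s_def ab by (simp add: algebra_simps power2_eq_square power3_eq_cube)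
  also have "\<dots> \<ge> 0"
    by simp
  finally have "s * (4 * (k - 1)\<^sup>2 * (k + 1) * (s + 1)) \<le> s * (s * (k * (4 * k\<^sup>2 - 1)))"
    using k by (intro mult_left_mono) auto
  moreover have "k * ((2 * k - 1) * (2 * k + 1)) > 0"
    using k by simp
  ultimately have "(k - 1)\<^sup>2 * ((k + 1) * s * (s + 1)) / (k * ((2 * k - 1) * (2 * k + 1))) \<le> s\<^sup>2 / 4"
    by (simp add: divide_le_eq) (simp add: algebra_simps power2_eq_square)
  moreover have "(d_entry m l)\<^sup>2 = (k - 1)\<^sup>2 * ((k + 1) * s * (s + 1)) / (k * ((2 * k - 1) * (2 * k + 1)))"
    using assms by (simp add: d_entry_power2 k_def s_def algebra_simps)
  moreover have "(real l / 2 + real m)\<^sup>2 = s\<^sup>2 / 4"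
    by (simp add: k_def s_def power2_eq_square field_simps)
  ultimately show "(d_entry m l)\<^sup>2 \<le> (real l / 2 + real m)\<^sup>2"
    by (simp only:)
qed simp

lemma d_entry_ge:
  assumes "l \<ge> 1" "m \<ge> 1"
  shows "real l / 2 + real m - 1 / 2 \<le> d_entry m l"
proof (rule power2_le_imp_le)
  obtain a b where ab: "l = Suc a" "m = Suc b"
    using assms by (metis One_nat_def Suc_le_D)
  define k s where "k = real l + real m" and "s = k + real m"
  have k: "k \<ge> 2" "s \<ge> 0"
    using assms by (auto simp: k_def s_def)
  have "4 * (k - 1)\<^sup>2 * (k + 1) * s * (s + 1) - (s - 1)\<^sup>2 * (k * (4 * k\<^sup>2 - 1))
     = 24 + 76 * real b + 88 * real b ^ 2 + 44 * real b ^ 3 + 8 * real b ^ 4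
      + 112 * real a + 240 * real a * real b + 164 * real a * real b ^ 2
      + 36 * real a * real b ^ 3 + 134 * real a ^ 2 + 177 * real a ^ 2 * real b
      + 56 * real a ^ 2 * real b ^ 2 + 57 * real a ^ 3 + 36 * real a ^ 3 * real b
      + 8 * real a ^ 4"
    unfolding k_def s_def ab
    by (simp add: algebra_simps power2_eq_square power3_eq_cube power4_eq_xxxx)
  also have "\<dots> \<ge> 0"
    by simp
  finally have "(s - 1)\<^sup>2 * (k * (4 * k\<^sup>2 - 1)) \<le> 4 * (k - 1)\<^sup>2 * (k + 1) * s * (s + 1)"
    by simp
  moreover have "k * ((2 * k - 1) * (2 * k + 1)) > 0"
    using k by simp
  ultimately have "(s - 1)\<^sup>2 / 4 \<le> (k - 1)\<^sup>2 * ((k + 1) * s * (s + 1)) / (k * ((2 * k - 1) * (2 * k + 1)))"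
    by (simp add: le_divide_eq) (simp add: algebra_simps power2_eq_square)
  moreover have "(d_entry m l)\<^sup>2 = (k - 1)\<^sup>2 * ((k + 1) * s * (s + 1)) / (k * ((2 * k - 1) * (2 * k + 1)))"
    using assms by (simp add: d_entry_power2 k_def s_def algebra_simps)
  moreover have "(real l / 2 + real m - 1 / 2)\<^sup>2 = (s - 1)\<^sup>2 / 4"
    by (simp add: k_def s_def power2_eq_square field_simps)
  ultimately show "(real l / 2 + real m - 1 / 2)\<^sup>2 \<le> (d_entry m l)\<^sup>2"
    by (simp only:)
qed (rule d_entry_nonneg[OF assms(1)])

lemma f_entry_le:
  assumes "l \<ge> 1" "m \<ge> 1"
  shows "f_entry m l \<le> (real l + 1) / 2"
proof (rule power2_le_imp_le)
  obtain a b where ab: "l = Suc a" "m = Suc b"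
    using assms by (metis One_nat_def Suc_le_D)
  define k where "k = real l + real m"
  have k: "k \<ge> 2"
    using assms by (auto simp: k_def)
  have "(real l + 1) * ((k + 1) * (2 * k + 1) * (2 * k + 3)) - 4 * (k + 2)\<^sup>2 * real l * k
     = 82 + 86 * real b + 32 * real b ^ 2 + 4 * real b ^ 3 + 63 * real a
      + 43 * real a * real b + 8 * real a * real b ^ 2 + 11 * real a ^ 2
      + 4 * real a ^ 2 * real b"
    unfolding k_def ab by (simp add: algebra_simps power2_eq_square power3_eq_cube)
  also have "\<dots> \<ge> 0"
    by simp
  finally have "(real l + 1) * (4 * (k + 2)\<^sup>2 * real l * k)
      \<le> (real l + 1) * ((real l + 1) * ((k + 1) * (2 * k + 1) * (2 * k + 3)))"
    by (intro mult_left_mono) auto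
  moreover have "(k + 1) * ((2 * k + 1) * (2 * k + 3)) > 0"
    using k by simp
  moreover have "4 * ((k + 2)\<^sup>2 * (real l * (real l + 1) * k))
      = (real l + 1) * (4 * (k + 2)\<^sup>2 * real l * k)"
    by algebra
  moreover have "4 * ((real l + 1)\<^sup>2 / 4 * ((k + 1) * ((2 * k + 1) * (2 * k + 3))))
      = (real l + 1) * ((real l + 1) * ((k + 1) * (2 * k + 1) * (2 * k + 3)))"
    by (simp add: power2_eq_square mult.assoc)
  ultimately have "(k + 2)\<^sup>2 * (real l * (real l + 1) * k) / ((k + 1) * ((2 * k + 1) * (2 * k + 3)))
      \<le> (real l + 1)\<^sup>2 / 4"
    by (simp only: pos_divide_le_eq)
  moreover have "(f_entry m l)\<^sup>2
      = (k + 2)\<^sup>2 * (real l * (real l + 1) * k) / ((k + 1) * ((2 * k + 1) * (2 * k + 3)))"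
    by (simp add: f_entry_power2 k_def algebra_simps)
  ultimately show "(f_entry m l)\<^sup>2 \<le> ((real l + 1) / 2)\<^sup>2"
    by (simp add: power_divide)
qed simp

section \<open>The norm of \<open>R_mat m\<close> and its quadratic form\<close>

text \<open>With \<open>n = CARD('n)\<close>, the three diagonals have norms at most
  \<open>n/2 + m\<close>, \<open>1\<close> and \<open>(n + 1)/2\<close>, which add up to the stated
  factor.\<close>

lemma norm_R_mat_mult_le:
  fixes x :: "real ^ 'n::{finite, linorder}"
  assumes "m \<ge> 1"
  shows "norm (R_mat m *v x) \<le> (real CARD('n) + real m + 3 / 2) * norm x"
proof -
  let ?D = "\<chi> i::'n. d_entry m (index i) * entry x (index i + 0)"
  let ?E = "\<chi> i::'n. e_entry m (index i) * entry x (index i + 1)"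
  let ?F = "\<chi> i::'n. f_entry m (index i) * entry x (index i + 2)"
  have "\<bar>d_entry m (index i)\<bar> \<le> real CARD('n) / 2 + real m" for i :: 'n
    using d_entry_le[OF index_ge_1 assms, of i] d_entry_nonneg[OF index_ge_1, of m i]
      index_le_card[of i] by linarith
  then have D: "norm ?D \<le> (real CARD('n) / 2 + real m) * norm x"
    by (intro norm_scaled_shift_le) auto
  have "\<bar>e_entry m (index i)\<bar> \<le> 1" for i :: 'n
    using e_entry_le[OF index_ge_1, of m i] e_entry_nonneg[of m "index i"] by simp
  then have E: "norm ?E \<le> 1 * norm x"
    by (intro norm_scaled_shift_le) auto
  have "\<bar>f_entry m (index i)\<bar> \<le> (real CARD('n) + 1) / 2" for i :: 'n
  proof -
    have "real (index i) \<le> real CARD('n)"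
      using index_le_card[of i] by simp
    then show ?thesis
      using f_entry_le[OF index_ge_1 assms, of i] f_entry_nonneg[of m "index i"] by simp
  qed
  then have F: "norm ?F \<le> ((real CARD('n) + 1) / 2) * norm x"
    by (intro norm_scaled_shift_le) auto
  have "R_mat m *v x = ?D - ?E - ?F"
    by (simp add: vec_eq_iff R_mat_mult)
  then have "norm (R_mat m *v x) \<le> norm ?D + norm ?E + norm ?F"
    using norm_triangle_ineq4[of "?D - ?E" ?F] norm_triangle_ineq4[of ?D ?E] by simp
  with D E F show ?thesis
    by (simp add: algebra_simps)
qed

text \<open>Each off-diagonal product is split evenly between the squares at its two positions.
  Position \<open>l\<close> is charged at most \<open>1/2 + (l+1)/4\<close> from its row and
  \<open>1/2 + (l-1)/4\<close> from its column; subtracting \<open>1 + l/2\<close> from the diagonal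
  bound \<open>l/2 + m - 1/2\<close> leaves \<open>m - 3/2\<close>.\<close>

lemma R_mat_inner_ge:
  fixes x :: "real ^ 'n::{finite, linorder}"
  assumes "m \<ge> 1"
  shows "(real m - 3 / 2) * (norm x)\<^sup>2 \<le> x \<bullet> (R_mat m *v x)"
proof -
  define X where "X = entry x"
  have young: "c * (u * v) \<le> C / 2 * u\<^sup>2 + C / 2 * v\<^sup>2" if "0 \<le> c" "c \<le> C" for c C u v :: real
  proof -
    have "u * v \<le> \<bar>u\<bar> * \<bar>v\<bar>"
      by (metis abs_ge_self abs_mult)
    also have "\<dots> \<le> (u\<^sup>2 + v\<^sup>2) / 2"
      using sum_squares_bound[of "\<bar>u\<bar>" "\<bar>v\<bar>"] by simp
    finally have "c * (u * v) \<le> c * ((u\<^sup>2 + v\<^sup>2) / 2)"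
      using that by (intro mult_left_mono)
    also have "\<dots> \<le> C * ((u\<^sup>2 + v\<^sup>2) / 2)"
      using that by (intro mult_right_mono) auto
    finally show ?thesis
      by (simp add: algebra_simps add_divide_distrib)
  qed
  have e_term: "e_entry m l * (X l * X (l + 1)) \<le> 1 / 2 * (X l)\<^sup>2 + 1 / 2 * (X (l + 1))\<^sup>2"
    if "l \<ge> 1" for l
    by (rule young[OF e_entry_nonneg e_entry_le[OF that]])
  \<comment> \<open>The second coefficient is written in terms of \<open>l + 2\<close>, so that it
    matches the weight \<open>(l - 1) / 4\<close> evaluated at the shifted position.\<close>
  have f_term: "f_entry m l * (X l * X (l + 2))
      \<le> (real l + 1) / 4 * (X l)\<^sup>2 + (real (l + 2) - 1) / 4 * (X (l + 2))\<^sup>2" if "l \<ge> 1" for l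
    using young[OF f_entry_nonneg f_entry_le[OF that assms], of "X l" "X (l + 2)"]
    by (simp add: add.commute)
  have "(real m - 3 / 2) * (norm x)\<^sup>2 = (\<Sum>i\<in>(UNIV :: 'n set). (real m - 3 / 2) * (X (index i))\<^sup>2)"
    by (simp add: power2_norm_vec sum_distrib_left X_def)
  also have "\<dots> = (\<Sum>i\<in>(UNIV :: 'n set). (real (index i) / 2 + real m - 1 / 2) * (X (index i))\<^sup>2)
      - (\<Sum>i\<in>(UNIV :: 'n set). 1 / 2 * (X (index i))\<^sup>2 + (real (index i) + 1) / 4 * (X (index i))\<^sup>2)
      - (\<Sum>i\<in>(UNIV :: 'n set). 1 / 2 * (X (index i))\<^sup>2)
      - (\<Sum>i\<in>(UNIV :: 'n set). (real (index i) - 1) / 4 * (X (index i))\<^sup>2)"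
    unfolding sum_subtractf[symmetric] by (intro sum.cong refl) (simp add: field_simps)
  \<comment> \<open>Passing to the shifted positions can only shrink the two subtracted
    sums.\<close>
  also have "\<dots> \<le> (\<Sum>i\<in>(UNIV :: 'n set). (real (index i) / 2 + real m - 1 / 2) * (X (index i))\<^sup>2)
      - (\<Sum>i\<in>(UNIV :: 'n set). 1 / 2 * (X (index i))\<^sup>2 + (real (index i) + 1) / 4 * (X (index i))\<^sup>2)
      - (\<Sum>i\<in>(UNIV :: 'n set). 1 / 2 * (X (index i + 1))\<^sup>2)
      - (\<Sum>i\<in>(UNIV :: 'n set). (real (index i + 2) - 1) / 4 * (X (index i + 2))\<^sup>2)"
    using sum_shift_entry_le[of "\<lambda>_. 1 / 2" 1 x]
      sum_shift_entry_le[of "\<lambda>l. (real l - 1) / 4" 2 x]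
    unfolding X_def entry_index by (intro diff_mono order_refl) auto
  also have "\<dots> = (\<Sum>i\<in>(UNIV :: 'n set). (real (index i) / 2 + real m - 1 / 2) * (X (index i))\<^sup>2
      - (1 / 2 * (X (index i))\<^sup>2 + 1 / 2 * (X (index i + 1))\<^sup>2)
      - ((real (index i) + 1) / 4 * (X (index i))\<^sup>2 + (real (index i + 2) - 1) / 4 * (X (index i + 2))\<^sup>2))"
    by (simp only: sum_subtractf sum.distrib)
  also have "\<dots> \<le> (\<Sum>i\<in>(UNIV :: 'n set). d_entry m (index i) * (X (index i))\<^sup>2
      - e_entry m (index i) * (X (index i) * X (index i + 1))
      - f_entry m (index i) * (X (index i) * X (index i + 2)))"
    by (intro sum_mono diff_mono e_term f_term index_ge_1 mult_right_mono d_entry_ge assms) simp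
  also have "\<dots> = x \<bullet> (R_mat m *v x)"
    by (simp add: inner_vec_def R_mat_mult X_def power2_eq_square algebra_simps)
  finally show ?thesis .
qed


section \<open>The borderline case\<close>

text \<open>For \<open>m = 1\<close> the row and column scalings \<open>row_scale\<close> and \<open>col_scale\<close> make the matrix rational.
  The sequences \<open>col_scale\<close> and \<open>1 / row_scale\<close> are null vectors of the rows and of the columns,
  up to boundary terms; both decay like the inverse square root. The harmonic factors in the
  weights below are what makes the products with \<open>R\<close> and its transpose strictly positive.\<close>

definition row_scale :: "nat \<Rightarrow> real" where
  "row_scale l = sqrt (real l * (real l + 3) / (2 * real l + 3))"

definition col_scale :: "nat \<Rightarrow> real" where
  "col_scale l = sqrt ((2 * real l + 1) / (real l * (real l + 1)))"

lemma row_scale_pos: "l \<ge> 1 \<Longrightarrow> row_scale l > 0"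
  by (simp add: row_scale_def)

lemma col_scale_pos: "l \<ge> 1 \<Longrightarrow> col_scale l > 0"
  by (simp add: col_scale_def)

lemma row_scale_power2: "(row_scale l)\<^sup>2 = real l * (real l + 3) / (2 * real l + 3)"
  by (simp add: row_scale_def)

lemma col_scale_power2: "(col_scale l)\<^sup>2 = (2 * real l + 1) / (real l * (real l + 1))"
  by (simp add: col_scale_def)

text \<open>Both sides are nonnegative and their squares agree as rational functions. In the scaled
  matrix the diagonal entry is the sum of the moduli of the other two, since
  \<open>(l+2)^2 - (l+1)^2 = 2*l + 3\<close>; this is why \<open>col_scale\<close> annihilates the
  rows away from the boundary.\<close>

lemma d_entry_scaled:
  assumes "l \<ge> 1"
  shows "d_entry 1 l * col_scale l = row_scale l * ((real l + 2) / (real l + 1))"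
proof (rule power2_eq_imp_eq)
  have "real l > 0"
    using assms by simp
  then show "(d_entry 1 l * col_scale l)\<^sup>2 = (row_scale l * ((real l + 2) / (real l + 1)))\<^sup>2"
    unfolding power_mult_distrib d_entry_power2[OF assms] row_scale_power2 col_scale_power2
    by (simp add: divide_simps) algebra
qed (use assms in \<open>simp_all add: d_entry_nonneg row_scale_def col_scale_def\<close>)

lemma e_entry_scaled:
  assumes "l \<ge> 1"
  shows "e_entry 1 l * col_scale (l + 1)
    = row_scale l * ((2 * real l + 3) / ((real l + 1) * (real l + 2)))"
proof (rule power2_eq_imp_eq)
  have "real l > 0"
    using assms by simp
  then show "(e_entry 1 l * col_scale (l + 1))\<^sup>2
      = (row_scale l * ((2 * real l + 3) / ((real l + 1) * (real l + 2))))\<^sup>2"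
    unfolding power_mult_distrib e_entry_def row_scale_power2 col_scale_power2
    by (simp add: divide_simps) algebra
qed (use assms in \<open>simp_all add: e_entry_nonneg row_scale_def col_scale_def\<close>)

lemma f_entry_scaled:
  assumes "l \<ge> 1"
  shows "f_entry 1 l * col_scale (l + 2) = row_scale l * ((real l + 1) / (real l + 2))"
proof (rule power2_eq_imp_eq)
  have "real l > 0"
    using assms by simp
  then show "(f_entry 1 l * col_scale (l + 2))\<^sup>2 = (row_scale l * ((real l + 1) / (real l + 2)))\<^sup>2"
    unfolding power_mult_distrib f_entry_power2 row_scale_power2 col_scale_power2
    by (simp add: divide_simps) algebra
qed (use assms in \<open>simp_all add: f_entry_nonneg row_scale_def col_scale_def\<close>)

section \<open>Harmonic weights and their row and column inequalities\<close>

lemma harm_pos_real: "n \<ge> 1 \<Longrightarrow> (harm n :: real) > 0"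
  by (simp add: harm_pos)

text \<open>The difference \<open>harm n - ln n\<close> decreases from its value 1 at
  \<open>n = 1\<close>.\<close>

lemma harm_le_one_plus_ln:
  assumes "n \<ge> 1"
  shows "harm n \<le> 1 + ln (real n)"
proof -
  have "harm (Suc (n - 1)) - ln (real (Suc (n - 1))) \<le> harm (Suc 0) - ln (real (Suc 0))"
    using decseqD[OF decseq_harm_diff_ln, of 0 "n - 1"] by simp
  also have "\<dots> = 1"
    by (simp add: harm_def)
  finally show ?thesis
    using assms by simp
qed

text \<open>The second factor stands for \<open>1 + log (n/l)\<close>. The summand 1 keeps it
  positive up to \<open>n\<close> and nonnegative at the two positions beyond.\<close>

definition col_weight :: "nat \<Rightarrow> nat \<Rightarrow> real" where
  "col_weight n l = col_scale l * (1 + harm n - harm l)"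

text \<open>Here \<open>harm l\<close> stands for \<open>1 + log l\<close>; its value 0 at
  \<open>l = 0\<close> removes the boundary terms of the first columns.\<close>

definition row_weight :: "nat \<Rightarrow> real" where
  "row_weight l = harm l / row_scale l"

text \<open>Past \<open>n\<close> the harmonic sum gains at most two terms, each at most 1/2, which
  the summand 1 absorbs.\<close>

lemma harm_col_factor_nonneg:
  assumes "n \<ge> 1" "l \<le> n + 2"
  shows "(0::real) \<le> 1 + harm n - harm l"
proof -
  have "harm l \<le> (harm (n + 2) :: real)"
    using assms by (intro harm_mono)
  also have "\<dots> = harm n + inverse (real n + 1) + inverse (real n + 2)"
    by (simp add: harm_Suc add.commute)
  finally have *: "harm l \<le> harm n + inverse (real n + 1) + inverse (real n + 2)" .
  have "inverse (real n + 1) \<le> 1 / 2" "inverse (real n + 2) \<le> 1 / 2"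
    using assms(1) by (auto simp: field_simps)
  with * show ?thesis
    by linarith
qed

text \<open>The common part \<open>g\<close> of the harmonic factors cancels because
  \<open>col_scale\<close> is a null vector; only the increments \<open>1/(r+1)\<close> and
  \<open>1/(r+2)\<close> survive, and they give the positive \<open>c\<close>. The factor
  \<open>harm n\<close> then covers the \<open>harm l\<close> in
  \<open>row_weight l\<close>.\<close>

lemma row_weight_le:
  assumes l: "1 \<le> l" "l \<le> n"
  shows "row_weight l \<le> 2 * harm n * (d_entry 1 l * col_weight n l
    - e_entry 1 l * col_weight n (l + 1) - f_entry 1 l * col_weight n (l + 2))"
proof -
  define r where "r = real l"
  have r: "r \<ge> 1"
    using l by (simp add: r_def)
  define g where "g = 1 + harm n - (harm l :: real)"
  have g1: "1 + harm n - harm (l + 1) = g - 1 / (r + 1)"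
    and g2: "1 + harm n - harm (l + 2) = g - 1 / (r + 1) - 1 / (r + 2)"
    by (simp_all add: g_def r_def harm_Suc inverse_eq_divide add.commute)
  define c where "c = (r + 2) / (r + 1) * g - (2 * r + 3) / ((r + 1) * (r + 2)) * (g - 1 / (r + 1))
    - (r + 1) / (r + 2) * (g - 1 / (r + 1) - 1 / (r + 2))"
  have c: "c = (2 * r + 3) * (r\<^sup>2 + 3 * r + 3) / ((r + 1)\<^sup>2 * (r + 2)\<^sup>2)"
    unfolding c_def using r by (simp add: divide_simps) algebra
  \<comment> \<open>With \<open>y = r^2 + 3*r\<close>, the inequality
    \<open>(y+2)^2 \<le> 2*y*(y+3)\<close> needed below says \<open>4 \<le> y*(y+2)\<close>.\<close>
  have "4 \<le> r\<^sup>2 + 3 * r"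
    using r one_le_power[OF r, of 2] by linarith
  then have "4 * 1 \<le> (r\<^sup>2 + 3 * r) * (r\<^sup>2 + 3 * r + 2)"
    by (intro mult_mono) auto
  then have "((r + 1) * (r + 2))\<^sup>2 \<le> 2 * (r * (r + 3)) * (r\<^sup>2 + 3 * r + 3)"
    by (simp add: algebra_simps power2_eq_square)
  then have "1 \<le> 2 * (row_scale l)\<^sup>2 * c"
    unfolding c row_scale_power2 r_def[symmetric] using r
    by (simp add: divide_simps power_mult_distrib mult_ac)
  then have "1 / row_scale l \<le> 2 * (row_scale l * c)"
    using row_scale_pos[OF l(1)] by (simp add: divide_le_eq power2_eq_square mult_ac)
  then have "harm l * (1 / row_scale l) \<le> harm n * (2 * (row_scale l * c))"
    using l row_scale_pos[OF l(1)] by (intro mult_mono harm_mono) (auto simp: harm_nonneg)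
  moreover have "d_entry 1 l * col_weight n l - e_entry 1 l * col_weight n (l + 1)
      - f_entry 1 l * col_weight n (l + 2) = row_scale l * c"
    unfolding col_weight_def g1 g2 g_def[symmetric] mult.assoc[symmetric]
      d_entry_scaled[OF l(1)] e_entry_scaled[OF l(1)] f_entry_scaled[OF l(1)] c_def r_def
    by (simp only: right_diff_distrib mult.assoc)
  ultimately show ?thesis
    by (simp add: row_weight_def mult_ac)
qed

lemma row_weight_0: "row_weight 0 = 0"
  by (simp add: row_weight_def harm_def)

text \<open>Multiplication by \<open>col_scale l\<close> makes the coefficients rational. For
  constant harmonic factors they cancel; from \<open>l = 2\<close> on the increments leave
  \<open>(2*r+3)/(r*(r+1))\<close>, which exceeds the square of \<open>col_scale l\<close>.\<close>

lemma col_scale_le: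
  assumes l: "l \<ge> 1"
  shows "col_scale l \<le> d_entry 1 l * row_weight l - e_entry 1 (l - 1) * row_weight (l - 1)
    - f_entry 1 (l - 2) * row_weight (l - 2)"
proof -
  define r where "r = real l"
  have r: "r \<ge> 1"
    using l by (simp add: r_def)
  have W: "col_scale l > 0"
    using l by (rule col_scale_pos)
  have d: "d_entry 1 l * row_weight l * col_scale l = (r + 2) / (r + 1) * harm l"
    using d_entry_scaled[OF l] row_scale_pos[OF l]
    by (simp add: row_weight_def r_def field_simps)
  have e: "e_entry 1 (l - 1) * row_weight (l - 1) * col_scale l
      = (2 * r + 1) / (r * (r + 1)) * harm (l - 1)"
  proof (cases "l = 1")
    case False
    then have k: "l - 1 \<ge> 1" "l - 1 + 1 = l" "real (l - 1) = r - 1"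
      using l by (auto simp: r_def of_nat_diff)
    have "e_entry 1 (l - 1) * row_weight (l - 1) * col_scale l
        = e_entry 1 (l - 1) * col_scale (l - 1 + 1) * (harm (l - 1) / row_scale (l - 1))"
      unfolding k(2) by (simp add: row_weight_def)
    also have "\<dots> = (2 * r + 1) / (r * (r + 1)) * harm (l - 1)"
      unfolding e_entry_scaled[OF k(1)] k(3) using row_scale_pos[OF k(1)]
      by (simp add: algebra_simps)
    finally show ?thesis .
  qed (simp add: row_weight_0, simp add: harm_def)
  have f: "f_entry 1 (l - 2) * row_weight (l - 2) * col_scale l = (r - 1) / r * harm (l - 2)"
  \<comment> \<open>For \<open>l \<le> 2\<close> truncated subtraction gives
    \<open>l - 2 = 0\<close>, and both sides vanish because \<open>harm 0 = 0\<close>.\<close>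
  proof (cases "l \<le> 2")
    case True
    then show ?thesis
      by (simp add: row_weight_0) (simp add: harm_def)
  next
    case False
    then have k: "l - 2 \<ge> 1" "l - 2 + 2 = l" "real (l - 2) = r - 2"
      using l by (auto simp: r_def of_nat_diff)
    have "f_entry 1 (l - 2) * row_weight (l - 2) * col_scale l
        = f_entry 1 (l - 2) * col_scale (l - 2 + 2) * (harm (l - 2) / row_scale (l - 2))"
      unfolding k(2) by (simp add: row_weight_def)
    also have "\<dots> = (r - 1) / r * harm (l - 2)"
      unfolding f_entry_scaled[OF k(1)] k(3) using row_scale_pos[OF k(1)]
      by (simp add: algebra_simps)
    finally show ?thesis .
  qed
  have "(2 * r + 1) / (r * (r + 1)) \<le> (r + 2) / (r + 1) * harm l
      - (2 * r + 1) / (r * (r + 1)) * harm (l - 1) - (r - 1) / r * harm (l - 2)"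
  proof (cases "l = 1")
    \<comment> \<open>At \<open>l = 1\<close> both sides equal 3/2.\<close>
    case True
    then show ?thesis
      by (simp add: r_def harm_def)
  next
    case False
    then obtain k where k: "l = Suc (Suc k)"
      using l by (metis One_nat_def Suc_le_D not0_implies_Suc)
    define h where "h = (harm k :: real)"
    have r2: "r \<ge> 2"
      by (simp add: r_def k)
    have h: "harm (l - 2) = h" "harm (l - 1) = h + 1 / (r - 1)" "harm l = h + 1 / (r - 1) + 1 / r"
      by (simp_all add: k h_def r_def harm_Suc inverse_eq_divide add.commute)
    have "(r + 2) / (r + 1) * harm l - (2 * r + 1) / (r * (r + 1)) * harm (l - 1)
        - (r - 1) / r * harm (l - 2) = (2 * r + 3) / (r * (r + 1))"
      unfolding h using r2 by (simp add: divide_simps) algebra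
    also have "\<dots> \<ge> (2 * r + 1) / (r * (r + 1))"
      using r by (intro divide_right_mono) auto
    finally show ?thesis .
  qed
  then have "col_scale l * col_scale l \<le> (d_entry 1 l * row_weight l
      - e_entry 1 (l - 1) * row_weight (l - 1) - f_entry 1 (l - 2) * row_weight (l - 2)) * col_scale l"
    unfolding left_diff_distrib d e f power2_eq_square[symmetric] col_scale_power2 r_def[symmetric] .
  with W show ?thesis
    by simp
qed

text \<open>The weighted test is applied with the row weights as \<open>p\<close>, the column
  weights as \<open>q\<close>, and constants \<open>2 * H\<close> and \<open>H\<close>; the harmonic
  number is replaced by a logarithm only at the end.\<close>

lemma R_mat_1_lower_bound:
  fixes x :: "real ^ 'n::{finite, linorder}"
  defines "n \<equiv> CARD('n)"
  shows "norm x \<le> 2 * (1 + ln (real n)) * norm (R_mat 1 *v x)"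
proof -
  define H where "H = (harm n :: real)"
  have n: "n \<ge> 1"
    by (simp add: n_def Suc_le_eq)
  have H: "H > 0"
    using n by (simp add: H_def harm_pos_real)
  define q where "q = (\<chi> i::'n. col_weight n (index i))"
  define p where "p = (\<chi> i::'n. row_weight (index i))"
  \<comment> \<open>An inequality suffices, as neighbours of \<open>q\<close> enter a row with
    nonpositive coefficients. Beyond \<open>n\<close> it compares 0 with a nonnegative
    weight.\<close>
  have entry_q: "entry q k \<le> col_weight n k" if "1 \<le> k" "k \<le> n + 2" for k
  proof (cases "k \<le> n")
    case True
    with that show ?thesis
      unfolding q_def by (subst entry_lambda) (auto simp: n_def)
  next
    case False
    with that show ?thesis
      using harm_col_factor_nonneg[OF n that(2)] col_scale_pos[OF that(1)]
      by (simp add: n_def entry_out_of_range col_weight_def)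
  qed
  have entry_p: "entry p k = row_weight k" if "k \<le> n" for k
  proof (cases "k = 0")
    case True
    then show ?thesis
      by (simp add: entry_out_of_range row_weight_0)
  next
    case False
    with that show ?thesis
      unfolding p_def by (subst entry_lambda) (auto simp: n_def)
  qed
  have "(norm x)\<^sup>2 \<le> (2 * H) * H * (norm (R_mat 1 *v x))\<^sup>2"
  proof (rule weighted_lower_bound[where p = p and q = q])
    fix i j :: 'n
    assume "i \<noteq> j"
    then show "(R_mat 1 :: real ^ ('n::{finite, linorder}) ^ ('n::{finite, linorder})) $ i $ j \<le> 0"
      by (auto simp: R_mat_def index_eq_iff e_entry_nonneg f_entry_nonneg)
  next
    fix i :: 'n
    have i: "1 \<le> index i" "index i \<le> n"
      using index_ge_1 index_le_card by (auto simp: n_def)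
    have "harm (index i) \<le> (harm n :: real)"
      using i by (intro harm_mono)
    then show "q $ i > 0"
      using col_scale_pos[OF i(1)] by (simp add: q_def col_weight_def)
    show "p $ i \<ge> 0"
      using row_scale_pos[OF i(1)] by (simp add: p_def row_weight_def harm_nonneg)
    have "p $ i \<le> 2 * H * (d_entry 1 (index i) * col_weight n (index i)
        - e_entry 1 (index i) * col_weight n (index i + 1)
        - f_entry 1 (index i) * col_weight n (index i + 2))"
      using row_weight_le[OF i] by (simp add: p_def H_def)
    also have "\<dots> \<le> 2 * H * (R_mat 1 *v q) $ i"
      unfolding R_mat_mult using i H
      by (intro mult_left_mono diff_mono entry_q
        d_entry_nonneg e_entry_nonneg f_entry_nonneg) (auto simp: q_def)
    finally show "p $ i \<le> 2 * H * (R_mat 1 *v q) $ i" .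
    \<comment> \<open>This bounds the factor \<open>1 + H - harm (index i)\<close> of the column
      weight by \<open>H\<close>.\<close>
    have "1 \<le> (harm (index i) :: real)"
      using harm_mono[OF i(1), where 'a = real] by (simp add: harm_def)
    then have "q $ i \<le> col_scale (index i) * H"
      using col_scale_pos[OF i(1)] by (simp add: q_def col_weight_def H_def)
    also have "\<dots> \<le> H * (transpose (R_mat 1) *v p) $ i"
      unfolding transpose_R_mat_mult using col_scale_le[OF i(1)] i H
      by (simp add: entry_p mult.commute) (simp add: p_def)
    finally show "q $ i \<le> H * (transpose (R_mat 1) *v p) $ i" .
  qed (use H in auto)
  \<comment> \<open>The constant \<open>2 * H^2\<close> is rounded up to the square
    \<open>(2 * H)^2\<close>.\<close>
  also have "\<dots> \<le> (2 * H * norm (R_mat 1 *v x))\<^sup>2"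
    using H by (simp add: power_mult_distrib power2_eq_square)
  finally have "norm x \<le> 2 * H * norm (R_mat 1 *v x)"
    by (rule power2_le_imp_le) (use H in simp)
  also have "\<dots> \<le> 2 * (1 + ln (real n)) * norm (R_mat 1 *v x)"
    using harm_le_one_plus_ln[OF n] by (intro mult_right_mono) (auto simp: H_def)
  finally show ?thesis .
qed

section \<open>The two condition number bounds\<close>

theorem theorem4p1:
  fixes n m :: nat
  assumes "n = CARD('n::{finite, linorder})" and "m \<ge> 1"
  shows "(m = 1 \<longrightarrow>
            kappa2 (R_mat m :: real ^ ('n::{finite, linorder}) ^ ('n::{finite, linorder}))
              \<le> (real n + 5 / 2) * (4 * exp (1 + 7 * pi\<^sup>2 / 8) * (2 + ln (real n))))
       \<and> (m \<ge> 2 \<longrightarrow>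
            kappa2 (R_mat m :: real ^ ('n::{finite, linorder}) ^ ('n::{finite, linorder}))
              \<le> (real n + real m + 3 / 2) / (real m - 3 / 2))"
proof (intro conjI impI)
  assume "m = 1"
  then have "kappa2 (R_mat m :: real ^ ('n::{finite, linorder}) ^ ('n::{finite, linorder}))
      \<le> (real n + real m + 3 / 2) * (2 * (1 + ln (real n)))"
    using norm_R_mat_mult_le[OF \<open>m \<ge> 1\<close>] R_mat_1_lower_bound
    unfolding assms(1) by (intro kappa2_le) auto
  also have "\<dots> \<le> (real n + 5 / 2) * (4 * exp (1 + 7 * pi\<^sup>2 / 8) * (2 + ln (real n)))"
  proof -
    have ln_nonneg: "ln (real n) \<ge> 0"
      using assms(1) by (simp add: Suc_le_eq)
    have "1 \<le> exp (1 + 7 * pi\<^sup>2 / 8)"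
      by simp
    \<comment> \<open>The exponential is bounded below by 1 only, which already makes each factor of
      \<open>2 * (1 + ln n)\<close> small enough.\<close>
    then have *: "2 \<le> 4 * exp (1 + 7 * pi\<^sup>2 / 8)"
      by linarith
    with ln_nonneg have "2 * (1 + ln (real n)) \<le> 4 * exp (1 + 7 * pi\<^sup>2 / 8) * (2 + ln (real n))"
      by (intro mult_mono) auto
    moreover have "real n + real m + 3 / 2 = real n + 5 / 2"
      using \<open>m = 1\<close> by simp
    ultimately show ?thesis
      by (metis add_nonneg_nonneg mult_left_mono of_nat_0_le_iff zero_le_divide_iff zero_le_numeral)
  qed
  finally show "kappa2 (R_mat m :: real ^ ('n::{finite, linorder}) ^ ('n::{finite, linorder}))
      \<le> (real n + 5 / 2) * (4 * exp (1 + 7 * pi\<^sup>2 / 8) * (2 + ln (real n)))" .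
next
  assume "m \<ge> 2"
  then have "real m - 3 / 2 > 0"
    by linarith
  then have "kappa2 (R_mat m :: real ^ ('n::{finite, linorder}) ^ ('n::{finite, linorder}))
      \<le> (real n + real m + 3 / 2) * (1 / (real m - 3 / 2))"
    unfolding assms(1)
    by (intro kappa2_le norm_R_mat_mult_le norm_le_of_inner_ge R_mat_inner_ge assms(2))
  then show "kappa2 (R_mat m :: real ^ ('n::{finite, linorder}) ^ ('n::{finite, linorder})) \<le> (real n + real m + 3 / 2) / (real m - 3 / 2)"
    by simp
qed

end
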